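(* Let $j\geq 2$ and $n\geq j$ be integers and let $f\in K_j^{[1]}$. Then $$f(x)\leq B_{n,j}(f;x)\leq B_n(f;x)\quad\text{for all } x\in[0,1].$$
   Context: $K_j^{[1]}$ is the set of all $f\in C[0,1]$ such that $f$ is increasing (in the weak sense, i.e. nondecreasing) and the function $g(x):=f(x^{1/j})$ is convex on $[0,1]$. With $p_{n,k}(x)=\binom{n}{k}x^k(1-x)^{n-k}$, the Bernstein operator $B_n$ and the Aldaz-Kounchev-Render operator $B_{n,j}$ (for integers $j\geq 2$, $n\geq j$) are defined on $C[0,1]$ by $$B_n(f;x)=\sum_{k=0}^n f\left(\frac{k}{n}\right)p_{n,k}(x),\qquad B_{n,j}(f;x)=\sum_{k=0}^n f\left(t_{n,k}^j\right)p_{n,k}(x),$$ where $$t_{n,k}^j=\left(\frac{k(k-1)\cdots(k-j+1)}{n(n-1)\cdots(n-j+1)}\right)^{1/j}$$ (the superscript $j$ in $t_{n,k}^j$ is an index, not a power). *)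

theory Defs
  imports "HOL-Analysis.Analysis"
begin

text \<open>
  The elements of \<open>C[0,1]\<close> are rendered as functions on the reals that are continuous on the
  closed unit interval; their values elsewhere play no role.
\<close>

definition K1 :: "nat \<Rightarrow> (real \<Rightarrow> real) set" where
  "K1 j = {f. continuous_on {0..1} f \<and> mono_on {0..1} f \<and>
              convex_on {0..1} (\<lambda>x. f (root j x))}"

definition bernstein_op :: "nat \<Rightarrow> (real \<Rightarrow> real) \<Rightarrow> real \<Rightarrow> real" where
  "bernstein_op n f x = (\<Sum>k=0..n. f (real k / real n) * Bernstein n k x)"

text \<open>Differences are taken in the reals; for \<open>k < j\<close> the numerator has the zero factor \<open>i = k\<close>.\<close>

definition akr_node :: "nat \<Rightarrow> nat \<Rightarrow> nat \<Rightarrow> real" where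
  "akr_node j n k =
     root j ((\<Prod>i<j. real k - real i) / (\<Prod>i<j. real n - real i))"

definition akr_op :: "nat \<Rightarrow> nat \<Rightarrow> (real \<Rightarrow> real) \<Rightarrow> real \<Rightarrow> real" where
  "akr_op n j f x = (\<Sum>k=0..n. f (akr_node j n k) * Bernstein n k x)"

end

theory Submission
  imports Defs
begin

text \<open>
  Put \<open>g y = f (root j y)\<close> and \<open>a k = (k choose j) / (n choose j)\<close>. Membership of \<open>f\<close> in
  \<open>K1 j\<close> makes \<open>g\<close> convex, and \<open>f\<close> sampled at the \<open>k\<close>-th node is \<open>g (a k)\<close>. For fixed \<open>x\<close> the
  Bernstein weights form a probability distribution on \<open>{0..n}\<close>, the binomial one, and the
  factorial moment of order \<open>j\<close> of the binomial distribution gives the numbers \<open>a k\<close> the mean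
  \<open>x ^ j\<close> (\<open>sum_choose_ratio_Bernstein\<close>). Jensen's inequality then yields
  \<open>f x = g (x ^ j) \<le> akr_op n j f x\<close>.

  For the upper bound, \<open>a k\<close> is zero if \<open>k < j\<close>, and otherwise a product of \<open>j\<close> nonnegative
  fractions \<open>(k - i) / (n - i)\<close>, each at most \<open>k / n\<close>. In both cases the node does
  not exceed \<open>k / n\<close> (\<open>akr_node_le\<close>). As \<open>f\<close> is nondecreasing and the weights are nonnegative,
  the sums compare term by term.
\<close>

lemma falling_prod_ratio_eq_choose_ratio:
  "(\<Prod>i<j. real k - real i) / (\<Prod>i<j. real n - real i) = real (k choose j) / real (n choose j)"
proof -
  have choose: "real (m choose j) = (\<Prod>i<j. real m - real i) / fact j" for m
    by (simp add: binomial_gbinomial gbinomial_prod_rev atLeast0LessThan)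
  show ?thesis
    by (simp add: choose)
qed

lemma akr_node_eq_choose_ratio:
  "akr_node j n k = root j (real (k choose j) / real (n choose j))"
  by (simp add: akr_node_def falling_prod_ratio_eq_choose_ratio)

text \<open>
  For \<open>k \<ge> j\<close> the bound holds factor by factor. For \<open>k < j\<close> the factors \<open>k - i\<close> can be negative,
  which spoils a comparison of products, but the factor with \<open>i = k\<close> makes the ratio zero.
\<close>

lemma choose_ratio_le_power:
  assumes "j \<le> n" "k \<le> n"
  shows "real (k choose j) / real (n choose j) \<le> (real k / real n) ^ j"
proof (cases "k < j")
  case True
  then show ?thesis by (simp add: binomial_eq_0)
next
  case False
  have "(\<Prod>i<j. (real k - real i) / (real n - real i)) \<le> (\<Prod>i<j. real k / real n)"
  proof (rule prod_mono, intro conjI)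
    fix i assume "i \<in> {..<j}"
    with False assms have i: "i < k" "i < n" by auto
    then show "0 \<le> (real k - real i) / (real n - real i)" by simp
    have "real i * real k \<le> real i * real n"
      using assms by (intro mult_left_mono) auto
    with i show "(real k - real i) / (real n - real i) \<le> real k / real n"
      by (simp add: divide_simps algebra_simps)
  qed
  then show ?thesis
    by (simp add: prod_dividef falling_prod_ratio_eq_choose_ratio)
qed

lemma choose_ratio_mem_unit_interval:
  assumes "k \<le> n"
  shows "real (k choose j) / real (n choose j) \<in> {0..1}"
  using binomial_right_mono[OF assms, of j] by (auto simp: divide_simps)

lemma akr_node_mem_unit_interval:
  assumes "0 < j" "k \<le> n"
  shows "akr_node j n k \<in> {0..1}"
  using choose_ratio_mem_unit_interval[OF assms(2), of j] assms(1)
  by (simp add: akr_node_eq_choose_ratio)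

lemma akr_node_le:
  assumes "0 < j" "j \<le> n" "k \<le> n"
  shows "akr_node j n k \<le> real k / real n"
proof -
  have "akr_node j n k \<le> root j ((real k / real n) ^ j)"
    using choose_ratio_le_power[OF assms(2,3)] assms(1) by (simp add: akr_node_eq_choose_ratio)
  also have "\<dots> = real k / real n"
    using assms(1) by (simp add: real_root_power_cancel)
  finally show ?thesis .
qed

text \<open>
  The factorial moment of the binomial distribution. The identity
  \<open>(n choose k) * (k choose j) = (n choose j) * (n - j choose k - j)\<close> turns each weighted term
  into \<open>x ^ j\<close> times a Bernstein polynomial of degree \<open>n - j\<close>, and these sum to \<open>1\<close>.
\<close>

lemma sum_choose_ratio_Bernstein:
  assumes "j \<le> n"
  shows "(\<Sum>k=0..n. Bernstein n k x * (real (k choose j) / real (n choose j))) = x ^ j"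
proof -
  have weighted: "Bernstein n (m + j) x * (real (m + j choose j) / real (n choose j))
      = x ^ j * Bernstein (n - j) m x" if "m \<le> n - j" for m
  proof -
    have "(n choose (m + j)) * (m + j choose j) = (n choose j) * (n - j choose m)"
      using choose_mult[of j "m + j" n] that assms by simp
    then have "real (n choose (m + j)) * real (m + j choose j)
        = real (n choose j) * real (n - j choose m)"
      by (metis of_nat_mult)
    moreover have "n - (m + j) = n - j - m" by simp
    ultimately show ?thesis
      using assms by (simp add: Bernstein_def divide_simps power_add mult_ac)
  qed
  have "(\<Sum>k=0..n. Bernstein n k x * (real (k choose j) / real (n choose j)))
      = (\<Sum>k=0+j..(n-j)+j. Bernstein n k x * (real (k choose j) / real (n choose j)))"
    using assms by (intro sum.mono_neutral_right) (auto simp: binomial_eq_0)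
  also have "\<dots> = (\<Sum>m=0..n-j. x ^ j * Bernstein (n - j) m x)"
    unfolding sum.shift_bounds_cl_nat_ivl by (intro sum.cong refl weighted) auto
  also have "\<dots> = x ^ j"
    by (simp add: sum_distrib_left[symmetric] atLeast0AtMost)
  finally show ?thesis .
qed

lemma le_akr_op:
  assumes "0 < j" "j \<le> n" "x \<in> {0..1}"
    and convex: "convex_on {0..1} (\<lambda>y. f (root j y))"
  shows "f x \<le> akr_op n j f x"
proof -
  have "f x = f (root j (\<Sum>k=0..n. Bernstein n k x *\<^sub>R (real (k choose j) / real (n choose j))))"
    using assms by (simp add: sum_choose_ratio_Bernstein real_root_power_cancel del: times_divide_eq_right)
  also have "\<dots> \<le> (\<Sum>k=0..n. Bernstein n k x * f (root j (real (k choose j) / real (n choose j))))"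
    using assms(3)
    by (intro convex_on_sum[OF _ _ convex])
       (use choose_ratio_mem_unit_interval in \<open>auto simp: Bernstein_nonneg atLeast0AtMost\<close>)
  also have "\<dots> = akr_op n j f x"
    by (simp add: akr_op_def akr_node_eq_choose_ratio mult.commute)
  finally show ?thesis .
qed

lemma akr_op_le_bernstein_op:
  assumes "0 < j" "j \<le> n" "x \<in> {0..1}" and mono: "mono_on {0..1} f"
  shows "akr_op n j f x \<le> bernstein_op n f x"
  unfolding akr_op_def bernstein_op_def
proof (intro sum_mono mult_right_mono)
  fix k assume "k \<in> {0..n}"
  then have "k \<le> n" by simp
  with assms show "f (akr_node j n k) \<le> f (real k / real n)"
    by (intro mono_onD[OF mono] akr_node_mem_unit_interval akr_node_le) auto
  show "0 \<le> Bernstein n k x"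
    using assms(3) by (simp add: Bernstein_nonneg)
qed

theorem proposition3p1:
  fixes j n :: nat and f :: "real \<Rightarrow> real"
  assumes "2 \<le> j" and "j \<le> n" and "f \<in> K1 j"
  shows "\<forall>x\<in>{0..1}. f x \<le> akr_op n j f x \<and> akr_op n j f x \<le> bernstein_op n f x"
  using assms by (auto simp: K1_def intro!: le_akr_op akr_op_le_bernstein_op)

end
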